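(* Let $(X,d)$ be a compact metric space, $f:X\to X$ a homeomorphism, and $\pi_0$ an ergodic $f$-invariant Borel probability measure on $X$. Assume that there exist finite Borel partitions $\mathcal{P}$ of $X$ of arbitrarily small diameter (i.e. for every $\eta>0$ there is one all of whose elements have diameter less than $\eta$) such that $h_{\pi_0}(f)=h:=h_{\pi_0}(f;\mathcal{P})$ and $$\limsup_{n\to\infty}\frac1n\log\pi_0\Bigl(\Bigl\{x\in X:\Bigl|-\frac1n\log\pi_0(\mathcal{P}^n(x))-h\Bigr|>\delta\Bigr\}\Bigr)<0$$ for all sufficiently small $\delta>0$, where $\mathcal{P}^n(x)$ denotes the unique element of $\mathcal{P}^n$ containing $x$. Let $C_0$ be the smallest channel capacity above which the asymptotic almost sure estimation objective (E2) can be achieved for every $\varepsilon>0$. Then $$C_0\ \le\ \log\bigl(1+\lfloor 2^{h_{\pi_0}(f)}\rfloor\bigr).$$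
   Context: All logarithms are to base $2$, with $\log\infty:=\infty$ and $\log 0:=-\infty$. The system is $x_{t+1}=f(x_t)$ with random initial state $x_0$ distributed according to $\pi_0$. Policies: given a finite nonempty alphabet $\mathcal{M}$ (noiseless channel of capacity $C=\log|\mathcal{M}|$), a coding and estimation policy consists of measurable maps $\delta_t:X^{t+1}\to\mathcal{M}$ and maps $\gamma_t:\mathcal{M}^{t+1}\to X$, $t=0,1,2,\dots$. For initial state $x_0$, put $x_t=f^t(x_0)$, $q_t=\delta_t(x_0,x_1,\dots,x_t)$ and $\hat{x}_t=\hat{x}_t(x_0)=\gamma_t(q_0,q_1,\dots,q_t)$. Objective (E2) for a given $\varepsilon>0$: $\pi_0(\{x_0\in X:\limsup_{t\to\infty}d(f^t(x_0),\hat{x}_t(x_0))\le\varepsilon\})=1$. $C_0$: for $\varepsilon>0$ let $C_\varepsilon$ be the infimum of $\log|\mathcal{M}|$ over all finite alphabets $\mathcal{M}$ for which there is a coding and estimation policy achieving the objective for this $\varepsilon$ (with $\inf\emptyset=\infty$); then $C_0:=\lim_{\varepsilon\downarrow0}C_\varepsilon$. Metric entropy: for a finite Borel partition $\mathcal{P}$ of $X$, $\mathcal{P}^n:=\bigvee_{i=0}^{n-1}f^{-i}\mathcal{P}$, $H_{\pi_0}(\mathcal{P}^n)=-\sum_{P\in\mathcal{P}^n}\pi_0(P)\log\pi_0(P)$, $h_{\pi_0}(f;\mathcal{P}):=\lim_{n\to\infty}\frac1nH_{\pi_0}(\mathcal{P}^n)$, and $h_{\pi_0}(f):=\sup_{\mathcal{P}}h_{\pi_0}(f;\mathcal{P})\in[0,\infty]$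 over all finite Borel partitions. *)

theory Defs
  imports "HOL-Probability.Probability"
begin

text \<open>The compact metric space is the whole type; compactness is assumed where needed.\<close>

definition elog :: "real \<Rightarrow> ereal" where
  "elog x = (if x = 0 then -\<infinity> else ereal (log 2 x))"


subsection \<open>Ergodic invariant measures\<close>

definition invariant_prob :: "('a::topological_space) measure \<Rightarrow> ('a \<Rightarrow> 'a) \<Rightarrow> bool" where
  "invariant_prob \<pi> f \<longleftrightarrow>
     prob_space \<pi> \<and> sets \<pi> = sets borel \<and> f \<in> measurable \<pi> \<pi> \<and> distr \<pi> \<pi> f = \<pi>"

definition ergodic :: "('a::topological_space) measure \<Rightarrow> ('a \<Rightarrow> 'a) \<Rightarrow> bool" where
  "ergodic \<pi> f \<longleftrightarrow>
     invariant_prob \<pi> f \<and>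
     (\<forall>A\<in>sets \<pi>. f -` A = A \<longrightarrow> measure \<pi> A = 0 \<or> measure \<pi> A = 1)"


subsection \<open>Metric entropy\<close>

definition finite_borel_partition :: "('a::topological_space) set set \<Rightarrow> bool" where
  "finite_borel_partition P \<longleftrightarrow> finite P \<and> partition_on UNIV P \<and> P \<subseteq> sets borel"

definition join_partition :: "('a \<Rightarrow> 'a) \<Rightarrow> 'a set set \<Rightarrow> nat \<Rightarrow> 'a set set" where
  "join_partition f P n = common_refinement ((\<lambda>i. (\<lambda>A. (f ^^ i) -` A) ` P) ` {..<n})"

definition partition_cell :: "('a \<Rightarrow> 'a) \<Rightarrow> 'a set set \<Rightarrow> nat \<Rightarrow> 'a \<Rightarrow> 'a set" where
  "partition_cell f P n x = (THE A. A \<in> join_partition f P n \<and> x \<in> A)"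

text \<open>Null elements contribute \<open>0\<close> to the entropy, since \<open>log 2 0\<close> is a real number.\<close>

definition partition_entropy :: "'a measure \<Rightarrow> 'a set set \<Rightarrow> real" where
  "partition_entropy \<pi> Q = - (\<Sum>A\<in>Q. measure \<pi> A * log 2 (measure \<pi> A))"

definition entropy_wrt :: "'a measure \<Rightarrow> ('a \<Rightarrow> 'a) \<Rightarrow> 'a set set \<Rightarrow> real" where
  "entropy_wrt \<pi> f P = lim (\<lambda>n. 1 / real n * partition_entropy \<pi> (join_partition f P n))"

definition metric_entropy :: "('a::topological_space) measure \<Rightarrow> ('a \<Rightarrow> 'a) \<Rightarrow> ereal" where
  "metric_entropy \<pi> f = (SUP P\<in>{P. finite_borel_partition P}. ereal (entropy_wrt \<pi> f P))"


subsection \<open>Coding and estimation\<close>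

text \<open>Alphabets are finite nonempty sets of natural numbers, which represent all finite alphabets
  up to renaming of letters. Finite sequences indexed by \<open>0, \<dots>, t\<close> are extensional functions
  on \<open>{..t}\<close>.\<close>

definition policy ::
  "nat set \<Rightarrow> (nat \<Rightarrow> (nat \<Rightarrow> 'a::topological_space) \<Rightarrow> nat) \<Rightarrow> (nat \<Rightarrow> (nat \<Rightarrow> nat) \<Rightarrow> 'a) \<Rightarrow> bool" where
  "policy M \<delta> \<gamma> \<longleftrightarrow>
     (\<forall>t. \<delta> t \<in> measurable (\<Pi>\<^sub>M i\<in>{..t}. borel) (count_space M) \<and>
          \<gamma> t \<in> measurable (\<Pi>\<^sub>M i\<in>{..t}. count_space M) borel)"

definition code_symbol ::
  "('a \<Rightarrow> 'a) \<Rightarrow> (nat \<Rightarrow> (nat \<Rightarrow> 'a) \<Rightarrow> nat) \<Rightarrow> 'a \<Rightarrow> nat \<Rightarrow> nat" where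
  "code_symbol f \<delta> x t = \<delta> t (\<lambda>i\<in>{..t}. (f ^^ i) x)"

definition estimate ::
  "('a \<Rightarrow> 'a) \<Rightarrow> (nat \<Rightarrow> (nat \<Rightarrow> 'a) \<Rightarrow> nat) \<Rightarrow> (nat \<Rightarrow> (nat \<Rightarrow> nat) \<Rightarrow> 'a) \<Rightarrow> 'a \<Rightarrow> nat \<Rightarrow> 'a" where
  "estimate f \<delta> \<gamma> x t = \<gamma> t (\<lambda>i\<in>{..t}. code_symbol f \<delta> x i)"

definition achieves_E2 ::
  "('a::metric_space) measure \<Rightarrow> ('a \<Rightarrow> 'a) \<Rightarrow> real \<Rightarrow>
   (nat \<Rightarrow> (nat \<Rightarrow> 'a) \<Rightarrow> nat) \<Rightarrow> (nat \<Rightarrow> (nat \<Rightarrow> nat) \<Rightarrow> 'a) \<Rightarrow> bool" where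
  "achieves_E2 \<pi> f \<epsilon> \<delta> \<gamma> \<longleftrightarrow>
     measure \<pi> {x. limsup (\<lambda>t. ereal (dist ((f ^^ t) x) (estimate f \<delta> \<gamma> x t))) \<le> ereal \<epsilon>} = 1"

definition C_eps :: "('a::metric_space) measure \<Rightarrow> ('a \<Rightarrow> 'a) \<Rightarrow> real \<Rightarrow> ereal" where
  "C_eps \<pi> f \<epsilon> =
     Inf {ereal (log 2 (real (card M))) | M.
            finite M \<and> M \<noteq> {} \<and> (\<exists>\<delta> \<gamma>. policy M \<delta> \<gamma> \<and> achieves_E2 \<pi> f \<epsilon> \<delta> \<gamma>)}"

definition C_zero :: "('a::metric_space) measure \<Rightarrow> ('a \<Rightarrow> 'a) \<Rightarrow> ereal" where
  "C_zero \<pi> f = Lim (at_right 0) (C_eps \<pi> f)"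

end

theory Submission
  imports Defs
begin

text \<open>Let \<open>h\<close> be the entropy, \<open>k = 1 + \<lfloor>2 powr h\<rfloor>\<close> and \<open>d > 0\<close> with \<open>h + d < log 2 k\<close>. For large \<open>n\<close> the
  cells of \<open>join_partition f P n\<close> with measure at least \<open>2 powr (- n * (h + d))\<close> number at most
  \<open>k ^ (n - 1)\<close>, so they can be addressed by words of length \<open>n - 1\<close> over \<open>k\<close> letters. Sending the
  address of the next block of length \<open>n\<close> during the current block of length \<open>n - 1\<close>, the receiver
  follows the orbit up to the diameter of \<open>P\<close>, except in blocks that start in an atypical cell. As
  the large deviation bound makes their probabilities summable, almost surely only finitely many
  blocks are exceptional by the Borel-Cantelli lemma.\<close>

section \<open>Finite Borel partitions and their joins along the orbit\<close>

text \<open>Such a set is a finite union of cells. This covers the level sets of encoders and the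
  large deviation sets, whose conditions depend on a point only through its cell.\<close>

lemma finite_borel_partition_saturated:
  assumes "finite_borel_partition Q"
    and "\<And>A x y. \<lbrakk>A \<in> Q; x \<in> A; y \<in> A; R x\<rbrakk> \<Longrightarrow> R y"
  shows "{x. R x} \<in> sets borel"
proof -
  have "{x. R x} = \<Union>{A \<in> Q. \<exists>x\<in>A. R x}"
    using assms unfolding finite_borel_partition_def partition_on_def by blast
  moreover have "\<Union>{A \<in> Q. \<exists>x\<in>A. R x} \<in> sets borel"
    using assms(1) unfolding finite_borel_partition_def by (intro sets.finite_Union) auto
  ultimately show ?thesis by simp
qed

lemma funpow_measurable:
  assumes "f \<in> measurable M M" shows "f ^^ n \<in> measurable M M"
proof (induction n)
  case (Suc n)
  show ?case using measurable_comp[OF Suc assms] by (simp add: comp_def)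
qed (simp add: id_def)

text \<open>Surjectivity keeps preimages of cells nonempty, as \<open>partition_on\<close> demands;
  the rest is finiteness of the refinement and measurability of the iterates.\<close>

lemma finite_borel_partition_join:
  fixes f :: "'a::topological_space \<Rightarrow> 'a"
  assumes P: "finite_borel_partition P" and f: "f \<in> measurable borel borel" and "surj f" and "0 < n"
  shows "finite_borel_partition (join_partition f P n)"
proof -
  let ?PP = "(\<lambda>i. (\<lambda>A. (f ^^ i) -` A) ` P) ` {..<n}"
  have part: "partition_on UNIV ((\<lambda>A. (f ^^ i) -` A) ` P)" for i
  proof (rule partition_onI)
    show "\<Union> ((\<lambda>A. (f ^^ i) -` A) ` P) = UNIV"
      using P unfolding finite_borel_partition_def partition_on_def by blast
    show "disjnt p q" if "p \<in> (\<lambda>A. (f ^^ i) -` A) ` P" "q \<in> (\<lambda>A. (f ^^ i) -` A) ` P" "p \<noteq> q" for p q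
    proof -
      from that obtain A B where "A \<in> P" "B \<in> P" "A \<noteq> B" "p = (f ^^ i) -` A" "q = (f ^^ i) -` B" by auto
      moreover from this have "A \<inter> B = {}"
        using P unfolding finite_borel_partition_def partition_on_def by (meson disjointD)
      ultimately show ?thesis by (auto simp: disjnt_def)
    qed
    show "{} \<notin> (\<lambda>A. (f ^^ i) -` A) ` P"
    proof
      assume "{} \<in> (\<lambda>A. (f ^^ i) -` A) ` P"
      then obtain A where "A \<in> P" "(f ^^ i) -` A = {}" by auto
      moreover have "A \<noteq> {}"
        using P \<open>A \<in> P\<close> unfolding finite_borel_partition_def partition_on_def by auto
      moreover have "surj (f ^^ i)" using \<open>surj f\<close> by (rule surj_fn)
      ultimately show False by (metis surj_image_vimage_eq image_empty)
    qed
  qed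
  have borel: "B \<in> sets borel" if "B \<in> \<P>" "\<P> \<in> ?PP" for B \<P>
  proof -
    from that obtain i A where "B = (f ^^ i) -` A" "A \<in> P" by auto
    then show ?thesis
      using measurable_sets[OF funpow_measurable[OF f], of A i] P
      unfolding finite_borel_partition_def by auto
  qed
  have "join_partition f P n \<subseteq> sets borel"
  proof
    fix C assume "C \<in> join_partition f P n"
    \<comment> \<open>A cell selects one preimage from each pulled-back partition, so it is a finite
      intersection of Borel sets.\<close>
    then obtain F where F: "F \<in> (\<Pi> \<P>\<in>?PP. \<P>)" and C: "C = \<Inter> (F ` ?PP)"
      unfolding join_partition_def common_refinement by blast
    show "C \<in> sets borel"
      unfolding C
    proof (rule sets.finite_INT)
      show "?PP \<noteq> {}" using \<open>0 < n\<close> by auto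
    next
      fix \<P> assume "\<P> \<in> ?PP"
      with F borel show "F \<P> \<in> sets borel" by (metis Pi_mem)
    qed simp
  qed
  moreover have "finite (join_partition f P n)"
    using P unfolding join_partition_def finite_borel_partition_def
    by (intro finite_common_refinement) auto
  moreover have "partition_on UNIV (join_partition f P n)"
    unfolding join_partition_def using part \<open>0 < n\<close>
    by (intro partition_on_common_refinement) auto
  ultimately show ?thesis by (simp add: finite_borel_partition_def)
qed

text \<open>A cell of a common refinement lies inside one member of each partition refined. Hence
  any representative of the cell shadows the orbit for \<open>n\<close> steps.\<close>

lemma join_partition_same_cell:
  assumes "A \<in> join_partition f P n" "x \<in> A" "y \<in> A" "i < n"
  obtains B where "B \<in> P" "(f ^^ i) x \<in> B" "(f ^^ i) y \<in> B"
proof -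
  have "\<exists>R\<in>(\<lambda>A. (f ^^ i) -` A) ` P. A \<subseteq> R"
    using assms(1) \<open>i < n\<close> unfolding join_partition_def by (intro common_refinement_exists) auto
  with assms that show thesis by blast
qed

lemma partition_cell_eq:
  assumes "finite_borel_partition (join_partition f P n)" "A \<in> join_partition f P n" "x \<in> A"
  shows "partition_cell f P n x = A"
  unfolding partition_cell_def
  using assms unfolding finite_borel_partition_def partition_on_def disjoint_def
  by (intro the_equality) auto

section \<open>Counting typical cells and summing exceptional probabilities\<close>

text \<open>The cells are disjoint, so their masses add up to at most 1.\<close>

lemma card_large_cells:
  assumes "prob_space \<pi>" "sets \<pi> = sets borel" "finite_borel_partition Q"
  shows "real (card {A \<in> Q. c \<le> measure \<pi> A}) * c \<le> 1"
proof -
  interpret prob_space \<pi> by fact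
  let ?G = "{A \<in> Q. c \<le> measure \<pi> A}"
  have fin: "finite ?G" and sub: "?G \<subseteq> sets \<pi>"
    using assms unfolding finite_borel_partition_def by auto
  have "real (card ?G) * c = (\<Sum>A\<in>?G. c)" by simp
  also have "\<dots> \<le> (\<Sum>A\<in>?G. measure \<pi> A)" by (rule sum_mono) auto
  also have "\<dots> = measure \<pi> (\<Union>A\<in>?G. A)"
    using fin sub assms(3)
    by (intro finite_measure_finite_Union[symmetric])
       (auto simp: finite_borel_partition_def partition_on_def disjoint_def disjoint_family_on_def)
  also have "\<dots> \<le> 1" by simp
  finally show ?thesis .
qed

text \<open>A negative exponential rate gives comparison with a geometric series of ratio
  \<open>2 powr c\<close>, where \<open>c\<close> lies strictly between the limsup and 0. Zero
  terms, with \<open>elog\<close> equal to minus infinity, are treated apart.\<close>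

lemma exponential_decay_summable:
  assumes lim: "limsup (\<lambda>n. ereal (1 / real n) * elog (u n)) < 0" and u: "\<And>n. 0 \<le> u n"
  shows "summable u"
proof -
  from ereal_dense2[OF lim] obtain c where c: "limsup (\<lambda>n. ereal (1 / real n) * elog (u n)) < ereal c" "c < 0"
    by (auto simp: zero_ereal_def)
  have ev: "\<forall>\<^sub>F n in sequentially. ereal (1 / real n) * elog (u n) < ereal c"
    using Limsup_lessD[OF c(1)] .
  have "\<forall>\<^sub>F n in sequentially. norm (u n) \<le> (2 powr c) ^ n"
    using ev eventually_gt_at_top[of 0]
  proof eventually_elim
    case (elim n)
    show ?case
    proof (cases "u n = 0")
      case False
      then have pos: "0 < u n" using u[of n] by linarith
      have "log 2 (u n) < c * real n"
        using elim False by (simp add: elog_def field_simps)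
      then have "u n < 2 powr (c * real n)"
        using pos by (simp add: log_less_iff)
      also have "\<dots> = (2 powr c) ^ n"
        by (simp add: powr_realpow[symmetric] powr_powr)
      finally show ?thesis using pos by simp
    qed simp
  qed
  moreover have "summable (\<lambda>n. (2 powr c) ^ n :: real)"
    using c(2) by (intro summable_geometric) (simp add: powr_less_one)
  ultimately show ?thesis by (rule summable_comparison_test_ev)
qed

text \<open>Outside the deviation set the information per step is at most \<open>h + d\<close>;
  exponentiating bounds the mass from below. A null cell has infinite information and is therefore
  never typical.\<close>

lemma measure_ge_of_information_le:
  assumes "\<not> \<bar>- (ereal (1 / real n) * elog p) - ereal h\<bar> > ereal d" "0 \<le> p" "0 < n"
  shows "2 powr (- (real n * (h + d))) \<le> p"
proof -
  have "p \<noteq> 0"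
  proof
    assume "p = 0"
    with assms show False by (simp add: elog_def)
  qed
  with assms have "- (log 2 p / real n) - h \<le> d" by (simp add: elog_def)
  then have "- (real n * (h + d)) \<le> log 2 p" using \<open>0 < n\<close> by (simp add: field_simps)
  then show ?thesis using \<open>p \<noteq> 0\<close> assms by (simp add: le_log_iff)
qed

section \<open>Block codes, the policy built from them, and estimation errors\<close>

text \<open>There are \<open>k ^ s\<close> words, enough to name the cells of \<open>G\<close>
  injectively. The decoder answers with an arbitrary point of the named cell.\<close>

lemma block_code_exists:
  fixes Q :: "'a::topological_space set set"
  assumes Q: "finite_borel_partition Q" and "G \<subseteq> Q" and card: "card G \<le> k ^ s" and "0 < k"
  obtains e :: "'a \<Rightarrow> nat \<Rightarrow> nat" and r :: "(nat \<Rightarrow> nat) \<Rightarrow> 'a"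
  where "\<And>x. e x \<in> {..<s} \<rightarrow>\<^sub>E {..<k}"
    and "e \<in> measurable borel (count_space ({..<s} \<rightarrow>\<^sub>E {..<k}))"
    and "\<And>A x. \<lbrakk>A \<in> G; x \<in> A\<rbrakk> \<Longrightarrow> r (e x) \<in> A"
proof -
  let ?W = "{..<s} \<rightarrow>\<^sub>E {..<k}"
  have finW: "finite ?W" by (intro finite_PiE) auto
  have finG: "finite G" using Q \<open>G \<subseteq> Q\<close> finite_subset unfolding finite_borel_partition_def by blast
  have "card G \<le> card ?W" using card by (simp add: card_PiE)
  then obtain g where g: "g ` G \<subseteq> ?W" "inj_on g G"
    using card_le_inj[OF finG finW] by blast
  have cell: "(THE A. A \<in> Q \<and> x \<in> A) = A" if "A \<in> Q" "x \<in> A" for A x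
    using that Q unfolding finite_borel_partition_def partition_on_def disjoint_def
    by (intro the_equality) auto
  \<comment> \<open>Cells outside \<open>G\<close> all get the zero word, a legal word since
    \<open>0 < k\<close>. It may coincide with the name of a cell in \<open>G\<close>, which is
    harmless because decoding is promised on \<open>G\<close> only.\<close>
  define e where "e = (\<lambda>x. let A = THE A. A \<in> Q \<and> x \<in> A in if A \<in> G then g A else (\<lambda>i\<in>{..<s}. 0))"
  define r where "r = (\<lambda>w. SOME y. y \<in> the_inv_into G g w)"
  have eW: "e x \<in> ?W" for x
    using g(1) \<open>0 < k\<close> unfolding e_def Let_def by (auto simp: image_subset_iff)
  show thesis
  proof
    show "e x \<in> ?W" for x by (rule eW)
    show "r (e x) \<in> A" if "A \<in> G" "x \<in> A" for A x
    proof -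
      have "A \<in> Q" using that \<open>G \<subseteq> Q\<close> by auto
      then have "e x = g A" using cell[of A x] that unfolding e_def by simp
      then have "the_inv_into G g (e x) = A" using g(2) that by (simp add: the_inv_into_f_f)
      then show ?thesis unfolding r_def using that by (auto intro: someI)
    qed
    have "{x. e x = w} \<in> sets borel" for w
      by (rule finite_borel_partition_saturated[OF Q]) (simp add: e_def cell)
    then show "e \<in> measurable borel (count_space ?W)"
      using finW eW by (subst measurable_count_space_eq2) (auto simp: vimage_def)
  qed
qed

text \<open>Cantor pairing \<open>prod_encode (m, j) = triangle (m + j) + m\<close> already cuts
  time into blocks: \<open>m + j\<close> is the block and \<open>m\<close> the offset in it.\<close>

lemma triangle_decomposition:
  obtains s m where "t = triangle s + m" "m \<le> s"
proof -
  obtain m j where "prod_decode t = (m, j)" by fastforce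
  then have "t = prod_encode (m, j)" by (metis prod_decode_inverse)
  then show thesis using that[of "m + j" m] by (simp add: prod_encode_def)
qed

lemma prod_decode_triangle:
  assumes "m \<le> s" shows "prod_decode (triangle s + m) = (m, s - m)"
  using assms by (simp add: prod_decode_triangle_add prod_decode_aux.simps[of s m])

lemma mono_triangle: "mono triangle"
  by (rule incseq_SucI) simp

text \<open>Time is cut into blocks of slowly growing length: block \<open>s\<close> consists of the \<open>s + 1\<close> times
  \<open>triangle s + m\<close>, \<open>m \<le> s\<close>. The cell of \<open>Q s\<close> visited at time \<open>triangle s\<close> is transmitted during
  block \<open>s - 1\<close>; the encoder can do this because the initial state determines the future.\<close>

lemma block_policy_exists:
  fixes f :: "'a::topological_space \<Rightarrow> 'a"
  assumes f: "f \<in> measurable borel borel"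
    and Q: "\<And>s. finite_borel_partition (Q s)" and G: "\<And>s. G s \<subseteq> Q s"
    and card: "\<forall>\<^sub>F s in sequentially. card (G s) \<le> k ^ s" and "0 < k"
  obtains \<delta> \<gamma> where "policy {..<k} \<delta> \<gamma>"
    and "\<forall>\<^sub>F s in sequentially. \<forall>x m. \<forall>A\<in>G s. m \<le> s \<longrightarrow> (f ^^ triangle s) x \<in> A \<longrightarrow>
           (\<exists>y\<in>A. estimate f \<delta> \<gamma> x (triangle s + m) = (f ^^ m) y)"
proof -
  \<comment> \<open>The cardinality bound holds only eventually. Making correct decoding conditional
    on it gives a code for every \<open>s\<close>, so that \<open>e\<close> and \<open>r\<close> can
    be chosen for all \<open>s\<close> at once.\<close>
  define code where "code = (\<lambda>s (e :: 'a \<Rightarrow> nat \<Rightarrow> nat) (r :: (nat \<Rightarrow> nat) \<Rightarrow> 'a).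
      (\<forall>x. e x \<in> {..<s} \<rightarrow>\<^sub>E {..<k}) \<and>
      e \<in> measurable borel (count_space ({..<s} \<rightarrow>\<^sub>E {..<k})) \<and>
      (card (G s) \<le> k ^ s \<longrightarrow> (\<forall>A\<in>G s. \<forall>x\<in>A. r (e x) \<in> A)))"
  have "\<exists>e r. code s e r" for s
  proof -
    define G' where "G' = (if card (G s) \<le> k ^ s then G s else {})"
    have "G' \<subseteq> Q s" "card G' \<le> k ^ s" using G[of s] by (simp_all add: G'_def)
    then show ?thesis
    proof (rule block_code_exists[OF Q _ _ \<open>0 < k\<close>])
      fix e :: "'a \<Rightarrow> nat \<Rightarrow> nat" and r :: "(nat \<Rightarrow> nat) \<Rightarrow> 'a"
      assume e: "\<And>x. e x \<in> {..<s} \<rightarrow>\<^sub>E {..<k}"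
        "e \<in> measurable borel (count_space ({..<s} \<rightarrow>\<^sub>E {..<k}))"
        and r: "\<And>A x. \<lbrakk>A \<in> G'; x \<in> A\<rbrakk> \<Longrightarrow> r (e x) \<in> A"
      have "r (e x) \<in> A" if "card (G s) \<le> k ^ s" "A \<in> G s" "x \<in> A" for A x
        using that by (intro r) (simp_all add: G'_def)
      with e have "code s e r" unfolding code_def by blast
      then show ?thesis by blast
    qed
  qed
  then obtain e r where code: "\<And>s. code s (e s) (r s)" by metis
  have e: "e s x \<in> {..<s} \<rightarrow>\<^sub>E {..<k}" for s x using code by (simp add: code_def)
  have e_meas: "e s \<in> measurable borel (count_space ({..<s} \<rightarrow>\<^sub>E {..<k}))" for s
    using code by (simp add: code_def)
  have r: "r s (e s x) \<in> A" if "card (G s) \<le> k ^ s" "A \<in> G s" "x \<in> A" for s A x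
    using code[of s] that unfolding code_def by blast
  \<comment> \<open>At offset \<open>m\<close> of block \<open>s\<close> the encoder sends letter
    \<open>m\<close> of the word for block \<open>s + 1\<close>, computing the future state from
    \<open>\<omega> 0\<close>.\<close>
  define \<delta> where "\<delta> = (\<lambda>t (\<omega> :: nat \<Rightarrow> 'a). let (m, j) = prod_decode t; s = m + j in
      e (Suc s) ((f ^^ triangle (Suc s)) (\<omega> 0)) m)"
  \<comment> \<open>The word for block \<open>s\<close> arrived at the times of block
    \<open>s - 1\<close>; its representative is advanced by \<open>m\<close> steps. For
    \<open>s = 0\<close> the word is empty and no symbol is read.\<close>
  define \<gamma> where "\<gamma> = (\<lambda>t w. let (m, j) = prod_decode t; s = m + j in
      (f ^^ m) (r s (\<lambda>i\<in>{..<s}. w (triangle (s - 1) + i))))"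
  have \<delta>_eq: "\<delta> (triangle s + m) = (\<lambda>\<omega>. e (Suc s) ((f ^^ triangle (Suc s)) (\<omega> 0)) m)" if "m \<le> s" for s m
    using that by (simp add: \<delta>_def prod_decode_triangle del: triangle_Suc)
  have \<delta>_meas: "\<delta> t \<in> measurable (\<Pi>\<^sub>M i\<in>{..t}. borel) (count_space {..<k})" for t
  proof -
    obtain s m where t: "t = triangle s + m" "m \<le> s" by (rule triangle_decomposition)
    have digit: "(\<lambda>w. w m) \<in> measurable (count_space ({..<Suc s} \<rightarrow>\<^sub>E {..<k})) (count_space {..<k})"
      using t by (auto simp: PiE_def Pi_def)
    have word: "(\<lambda>\<omega>. e (Suc s) ((f ^^ triangle (Suc s)) (\<omega> 0)))
        \<in> measurable (\<Pi>\<^sub>M i\<in>{..t}. borel) (count_space ({..<Suc s} \<rightarrow>\<^sub>E {..<k}))"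
      by (intro measurable_compose[OF _ e_meas] measurable_compose[OF _ funpow_measurable[OF f]]
          measurable_component_singleton) simp
    have "(\<lambda>\<omega>. e (Suc s) ((f ^^ triangle (Suc s)) (\<omega> 0)) m)
        \<in> measurable (\<Pi>\<^sub>M i\<in>{..t}. borel) (count_space {..<k})"
      by (rule measurable_compose[OF word digit])
    then show ?thesis by (simp only: t(1) \<delta>_eq[OF t(2)])
  qed
  have "\<gamma> t \<in> measurable (\<Pi>\<^sub>M i\<in>{..t}. count_space {..<k}) borel" for t
    \<comment> \<open>Over a finite alphabet the product space is discrete, so every decoder is
      measurable.\<close>
    by (subst count_space_PiM_finite) auto
  with \<delta>_meas have "policy {..<k} \<delta> \<gamma>" by (simp add: policy_def)
  moreover have "\<forall>\<^sub>F s in sequentially. \<forall>x m. \<forall>A\<in>G s. m \<le> s \<longrightarrow> (f ^^ triangle s) x \<in> A \<longrightarrow>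
           (\<exists>y\<in>A. estimate f \<delta> \<gamma> x (triangle s + m) = (f ^^ m) y)"
    \<comment> \<open>Block 0 has no predecessor in which its word could be sent.\<close>
    using card eventually_gt_at_top[of 0]
  proof eventually_elim
    case (elim s)
    then obtain s' where s': "s = Suc s'" by (cases s) auto
    show ?case
    proof (intro allI ballI impI)
      fix x m A assume A: "A \<in> G s" "(f ^^ triangle s) x \<in> A" and m: "m \<le> s"
      have sym: "code_symbol f \<delta> x (triangle s' + i) = e s ((f ^^ triangle s) x) i" if "i \<le> s'" for i
        using that by (simp add: code_symbol_def \<delta>_eq s' del: triangle_Suc)
      \<comment> \<open>The received letters reassemble the word: all of them were sent before time
        \<open>triangle s\<close>, and both sides are undefined off \<open>{..<s}\<close>.\<close>
      have "(\<lambda>i\<in>{..<s}. (\<lambda>i\<in>{..triangle s + m}. code_symbol f \<delta> x i) (triangle (s - 1) + i))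
          = e s ((f ^^ triangle s) x)"
      proof (rule ext)
        fix i
        show "(\<lambda>i\<in>{..<s}. (\<lambda>i\<in>{..triangle s + m}. code_symbol f \<delta> x i) (triangle (s - 1) + i)) i
          = e s ((f ^^ triangle s) x) i"
        proof (cases "i < s")
          case True
          then have "triangle s' + i \<le> triangle s + m" "i \<le> s'" by (auto simp: s')
          then show ?thesis using True sym[of i] by (simp add: s' del: triangle_Suc)
        next
          case False
          then show ?thesis using e[of s "(f ^^ triangle s) x"] by (auto simp: PiE_def extensional_def)
        qed
      qed
      then have "estimate f \<delta> \<gamma> x (triangle s + m) = (f ^^ m) (r s (e s ((f ^^ triangle s) x)))"
        using m by (simp add: estimate_def \<gamma>_def prod_decode_triangle)
      moreover have "r s (e s ((f ^^ triangle s) x)) \<in> A" using r elim A by blast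
      ultimately show "\<exists>y\<in>A. estimate f \<delta> \<gamma> x (triangle s + m) = (f ^^ m) y" by blast
    qed
  qed
  ultimately show thesis by (rule that)
qed

text \<open>On a metric space without a countable base \<open>dist\<close> need not be jointly measurable; here it is
  enough that the estimate takes only finitely many values at each time.\<close>

lemma estimation_error_measurable:
  fixes f :: "'a::metric_space \<Rightarrow> 'a"
  assumes f: "f \<in> measurable borel borel" and pol: "policy M \<delta> \<gamma>" and "finite M"
  shows "(\<lambda>x. dist ((f ^^ t) x) (estimate f \<delta> \<gamma> x t)) \<in> borel_measurable borel"
proof -
  have sym: "(\<lambda>x. code_symbol f \<delta> x i) \<in> measurable borel (count_space M)" for i
  proof -
    have "(\<lambda>x. \<lambda>j\<in>{..i}. (f ^^ j) x) \<in> measurable borel (\<Pi>\<^sub>M j\<in>{..i}. borel)"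
      by (intro measurable_restrict funpow_measurable[OF f])
    moreover have "\<delta> i \<in> measurable (\<Pi>\<^sub>M j\<in>{..i}. borel) (count_space M)"
      using pol by (simp add: policy_def)
    ultimately show ?thesis unfolding code_symbol_def by (rule measurable_compose)
  qed
  have word: "(\<lambda>x. \<lambda>i\<in>{..t}. code_symbol f \<delta> x i)
      \<in> measurable borel (count_space ({..t} \<rightarrow>\<^sub>E M))"
  proof -
    have "(\<lambda>x. \<lambda>i\<in>{..t}. code_symbol f \<delta> x i) \<in> measurable borel (\<Pi>\<^sub>M i\<in>{..t}. count_space M)"
      by (intro measurable_restrict sym)
    also have "(\<Pi>\<^sub>M i\<in>{..t}. count_space M) = count_space ({..t} \<rightarrow>\<^sub>E M)"
      using \<open>finite M\<close> by (intro count_space_PiM_finite) (auto intro: countable_finite)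
    finally show ?thesis .
  qed
  have cont: "(\<lambda>z. dist z y) \<in> borel_measurable borel" for y :: 'a
    by (intro borel_measurable_continuous_onI continuous_intros)
  show ?thesis
    unfolding estimate_def
  \<comment> \<open>Once the received word is fixed, the estimate is a constant point, and the
    distance to it is continuous.\<close>
  proof (rule measurable_compose_countable'[OF _ word])
    show "(\<lambda>x. dist ((f ^^ t) x) (\<gamma> t w)) \<in> borel_measurable borel" for w
      by (rule measurable_compose[OF funpow_measurable[OF f] cont])
    show "countable ({..t} \<rightarrow>\<^sub>E M)"
      using \<open>finite M\<close> by (intro countable_finite finite_PiE) auto
  qed
qed

section \<open>The objective (E2) and the limit defining \<open>C_zero\<close>\<close>

text \<open>The passage between \<open>measure\<close> and \<open>AE\<close> rests on measurability
  of the success set, which follows from that of the error at each time.\<close>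

lemma achieves_E2_iff_AE:
  fixes f :: "'a::metric_space \<Rightarrow> 'a"
  assumes inv: "invariant_prob \<pi> f" and pol: "policy M \<delta> \<gamma>" and "finite M"
  shows "achieves_E2 \<pi> f \<epsilon> \<delta> \<gamma> \<longleftrightarrow>
    (AE x in \<pi>. limsup (\<lambda>t. ereal (dist ((f ^^ t) x) (estimate f \<delta> \<gamma> x t))) \<le> ereal \<epsilon>)"
proof -
  interpret prob_space \<pi> using inv by (simp add: invariant_prob_def)
  have sets: "sets \<pi> = sets borel" and "f \<in> measurable \<pi> \<pi>" using inv by (auto simp: invariant_prob_def)
  then have f: "f \<in> measurable borel borel" by (simp cong: measurable_cong_sets)
  have space: "space \<pi> = UNIV" using sets_eq_imp_space_eq[OF sets] by simp
  note [measurable] = estimation_error_measurable[OF f pol \<open>finite M\<close>]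
  have "{x. limsup (\<lambda>t. ereal (dist ((f ^^ t) x) (estimate f \<delta> \<gamma> x t))) \<le> ereal \<epsilon>} \<in> sets borel"
    by measurable
  then show ?thesis
    using prob_Collect_eq_1[of "\<lambda>x. limsup (\<lambda>t. ereal (dist ((f ^^ t) x) (estimate f \<delta> \<gamma> x t))) \<le> ereal \<epsilon>"]
    by (simp add: achieves_E2_def sets space)
qed

lemma achieves_E2_mono:
  fixes f :: "'a::metric_space \<Rightarrow> 'a"
  assumes "invariant_prob \<pi> f" "policy M \<delta> \<gamma>" "finite M" "achieves_E2 \<pi> f \<epsilon> \<delta> \<gamma>" "\<epsilon> \<le> \<epsilon>'"
  shows "achieves_E2 \<pi> f \<epsilon>' \<delta> \<gamma>"
proof -
  have "AE x in \<pi>. limsup (\<lambda>t. ereal (dist ((f ^^ t) x) (estimate f \<delta> \<gamma> x t))) \<le> ereal \<epsilon>"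
    using assms by (simp add: achieves_E2_iff_AE)
  then have "AE x in \<pi>. limsup (\<lambda>t. ereal (dist ((f ^^ t) x) (estimate f \<delta> \<gamma> x t))) \<le> ereal \<epsilon>'"
    by eventually_elim (use \<open>\<epsilon> \<le> \<epsilon>'\<close> in \<open>auto intro: order_trans\<close>)
  then show ?thesis using assms by (simp add: achieves_E2_iff_AE)
qed

text \<open>A larger tolerance admits more alphabets to the infimum.\<close>

lemma C_eps_antimono:
  fixes f :: "'a::metric_space \<Rightarrow> 'a"
  assumes "invariant_prob \<pi> f" "\<epsilon> \<le> \<epsilon>'"
  shows "C_eps \<pi> f \<epsilon>' \<le> C_eps \<pi> f \<epsilon>"
  unfolding C_eps_def
proof (rule Inf_superset_mono, clarify)
  fix M :: "nat set" and \<delta> :: "nat \<Rightarrow> (nat \<Rightarrow> 'a) \<Rightarrow> nat" and \<gamma> :: "nat \<Rightarrow> (nat \<Rightarrow> nat) \<Rightarrow> 'a"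
  assume M: "finite M" "M \<noteq> {}" and pol: "policy M \<delta> \<gamma>" and "achieves_E2 \<pi> f \<epsilon> \<delta> \<gamma>"
  then have "achieves_E2 \<pi> f \<epsilon>' \<delta> \<gamma>" using achieves_E2_mono assms by blast
  with M pol show "\<exists>N. ereal (log 2 (real (card M))) = ereal (log 2 (real (card N))) \<and>
      finite N \<and> N \<noteq> {} \<and> (\<exists>\<delta> \<gamma>. policy N \<delta> \<gamma> \<and> achieves_E2 \<pi> f \<epsilon>' \<delta> \<gamma>)"
    by blast
qed

text \<open>A value below the supremum is exceeded at some \<open>x\<close>, hence by monotonicity
  on all of the interval from \<open>a\<close> to \<open>x\<close>.\<close>

lemma tendsto_SUP_at_right_antimono:
  fixes g :: "real \<Rightarrow> 'b::{complete_linorder, linorder_topology}"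
  assumes "\<And>x y. a < x \<Longrightarrow> x \<le> y \<Longrightarrow> g y \<le> g x"
  shows "(g \<longlongrightarrow> (SUP x\<in>{a<..}. g x)) (at_right a)"
proof (rule order_tendstoI)
  fix l assume "l < (SUP x\<in>{a<..}. g x)"
  then obtain x where x: "a < x" "l < g x" by (auto simp: less_SUP_iff)
  show "\<forall>\<^sub>F y in at_right a. l < g y"
    unfolding eventually_at_right_field
  proof (intro exI[of _ x] conjI allI impI)
    fix y assume "a < y" "y < x"
    then have "g x \<le> g y" by (intro assms) auto
    with x(2) show "l < g y" by (rule less_le_trans)
  qed (rule x)
next
  fix u assume u: "(SUP x\<in>{a<..}. g x) < u"
  have "g y < u" if "a < y" for y
    using that by (intro le_less_trans[OF SUP_upper u]) simp
  then show "\<forall>\<^sub>F y in at_right a. g y < u"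
    unfolding eventually_at_right_field by (intro exI[of _ "a + 1"]) auto
qed

text \<open>\<open>Lim\<close> is a definite description, so convergence has to be established
  first; monotonicity identifies the limit as a supremum.\<close>

lemma C_zero_le:
  fixes f :: "'a::metric_space \<Rightarrow> 'a"
  assumes "invariant_prob \<pi> f" and le: "\<And>\<epsilon>. 0 < \<epsilon> \<Longrightarrow> C_eps \<pi> f \<epsilon> \<le> c"
  shows "C_zero \<pi> f \<le> c"
proof -
  have "(C_eps \<pi> f \<longlongrightarrow> (SUP \<epsilon>\<in>{0<..}. C_eps \<pi> f \<epsilon>)) (at_right 0)"
    by (rule tendsto_SUP_at_right_antimono) (rule C_eps_antimono[OF assms(1)])
  then have "C_zero \<pi> f = (SUP \<epsilon>\<in>{0<..}. C_eps \<pi> f \<epsilon>)"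
    unfolding C_zero_def by (intro tendsto_Lim) auto
  then show ?thesis using le by (auto intro: SUP_least)
qed

section \<open>The capacity bound by Borel-Cantelli\<close>

text \<open>Stationarity lets exceptional events at the start of a late block be measured as if the
  block began at time 0.\<close>

lemma invariant_measure_funpow_vimage:
  assumes "invariant_prob \<pi> f" "A \<in> sets \<pi>"
  shows "measure \<pi> ((f ^^ n) -` A) = measure \<pi> A" "(f ^^ n) -` A \<in> sets \<pi>"
proof -
  have sets: "sets \<pi> = sets borel" and f: "f \<in> measurable \<pi> \<pi>" and d: "distr \<pi> \<pi> f = \<pi>"
    using assms(1) by (auto simp: invariant_prob_def)
  have space: "space \<pi> = UNIV" using sets_eq_imp_space_eq[OF sets] by simp
  show meas: "(f ^^ n) -` A \<in> sets \<pi>" for n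
    using measurable_sets[OF funpow_measurable[OF f] assms(2), of n] by (simp add: space)
  show "measure \<pi> ((f ^^ n) -` A) = measure \<pi> A"
  proof (induction n)
    case (Suc n)
    have "measure \<pi> ((f ^^ n) -` A) = measure (distr \<pi> \<pi> f) ((f ^^ n) -` A)" by (simp add: d)
    also have "\<dots> = measure \<pi> (f -` ((f ^^ n) -` A))"
      using f meas by (simp add: measure_distr space)
    also have "f -` ((f ^^ n) -` A) = (f ^^ Suc n) -` A" by (simp only: vimage_comp funpow_Suc_right)
    finally show ?case using Suc by (simp only:)
  qed simp
qed

text \<open>Only \<open>s\<close> letters are available for a cell describing \<open>Suc s\<close>
  states; the strict gap between \<open>c\<close> and \<open>log 2 k\<close> absorbs the missing
  letter for large \<open>s\<close>.\<close>

lemma eventually_powr_le_power: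
  assumes "c < log 2 (real k)" "0 < k"
  shows "\<forall>\<^sub>F s in sequentially. 2 powr (real (Suc s) * c) \<le> real k ^ s"
proof -
  have "filterlim (\<lambda>s. (log 2 (real k) - c) * real s) at_top sequentially"
    by (rule filterlim_tendsto_pos_mult_at_top[OF tendsto_const _ filterlim_real_sequentially])
       (use assms in simp)
  then have "\<forall>\<^sub>F s in sequentially. c \<le> (log 2 (real k) - c) * real s"
    by (simp add: filterlim_at_top)
  then show ?thesis
  proof eventually_elim
    case (elim s)
    have "2 powr (real (Suc s) * c) \<le> 2 powr (log 2 (real k) * real s)"
      using elim by (simp add: algebra_simps)
    also have "\<dots> = real k ^ s"
      using \<open>0 < k\<close> by (simp add: powr_powr[symmetric] powr_realpow)
    finally show ?case .
  qed
qed

lemma C_eps_le_log: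
  fixes f :: "'a::metric_space \<Rightarrow> 'a"
  assumes "bounded (UNIV :: 'a set)" and inv: "invariant_prob \<pi> f" and "surj f"
    and P: "finite_borel_partition P" and diam: "\<And>A. A \<in> P \<Longrightarrow> diameter A < \<epsilon>"
    and dev: "\<forall>\<^sub>F d in at_right (0::real).
        limsup (\<lambda>n. ereal (1 / real n) *
          elog (measure \<pi>
            {x. \<bar>- (ereal (1 / real n) * elog (measure \<pi> (partition_cell f P n x)))
                  - ereal h\<bar> > ereal d})) < 0"
    and k: "h < log 2 (real k)" "0 < k"
  shows "C_eps \<pi> f \<epsilon> \<le> ereal (log 2 (real k))"
proof -
  interpret prob_space \<pi> using inv by (simp add: invariant_prob_def)
  have sets: "sets \<pi> = sets borel" and "f \<in> measurable \<pi> \<pi>" using inv by (auto simp: invariant_prob_def)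
  then have f: "f \<in> measurable borel borel" by (simp cong: measurable_cong_sets)
  define B where "B = (\<lambda>d n. {x. \<bar>- (ereal (1 / real n) * elog (measure \<pi> (partition_cell f P n x)))
                  - ereal h\<bar> > ereal d})"
  \<comment> \<open>The strict inequality \<open>h < log 2 k\<close> leaves room for a
    \<open>d\<close> that also satisfies the deviation bound.\<close>
  have "\<forall>\<^sub>F d in at_right (0::real). d < log 2 (real k) - h"
    using k unfolding eventually_at_right_field by (intro exI[of _ "log 2 (real k) - h"]) auto
  with dev have "\<forall>\<^sub>F d in at_right (0::real). h + d < log 2 (real k) \<and>
      limsup (\<lambda>n. ereal (1 / real n) * elog (measure \<pi> (B d n))) < 0"
    unfolding B_def by eventually_elim auto
  then obtain d where d: "h + d < log 2 (real k)"
    and lim: "limsup (\<lambda>n. ereal (1 / real n) * elog (measure \<pi> (B d n))) < 0"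
    using eventually_happens'[OF trivial_limit_at_right_real] by blast
  \<comment> \<open>Block \<open>s\<close> has offsets 0 to \<open>s\<close>, hence
    \<open>Suc s\<close> iterates.\<close>
  define Q where "Q = (\<lambda>s. join_partition f P (Suc s))"
  define G where "G = (\<lambda>s. {A \<in> Q s. 2 powr (- (real (Suc s) * (h + d))) \<le> measure \<pi> A})"
  have Q: "finite_borel_partition (Q s)" for s
    unfolding Q_def by (rule finite_borel_partition_join[OF P f \<open>surj f\<close>]) simp
  have cell: "partition_cell f P (Suc s) x = A" if "A \<in> Q s" "x \<in> A" for s x A
    using partition_cell_eq Q that unfolding Q_def by blast
  have G_sub: "G s \<subseteq> Q s" for s by (auto simp: G_def)
  have card: "\<forall>\<^sub>F s in sequentially. card (G s) \<le> k ^ s"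
    using eventually_powr_le_power[OF d k(2)]
  proof eventually_elim
    case (elim s)
    define c where "c = real (Suc s) * (h + d)"
    have "real (card (G s)) * 2 powr (- c) \<le> 1"
      unfolding G_def c_def by (rule card_large_cells[OF prob_space_axioms sets Q])
    then have "real (card (G s)) \<le> 2 powr c"
      by (simp add: powr_minus field_simps)
    also have "\<dots> \<le> real k ^ s" using elim by (simp add: c_def)
    finally show ?case by (metis of_nat_le_iff of_nat_power)
  qed
  obtain \<delta> \<gamma> where pol: "policy {..<k} \<delta> \<gamma>"
    and est: "\<forall>\<^sub>F s in sequentially. \<forall>x m. \<forall>A\<in>G s. m \<le> s \<longrightarrow> (f ^^ triangle s) x \<in> A \<longrightarrow>
           (\<exists>y\<in>A. estimate f \<delta> \<gamma> x (triangle s + m) = (f ^^ m) y)"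
    by (rule block_policy_exists[OF f Q G_sub card k(2)])
  have B_meas: "B d (Suc s) \<in> sets \<pi>" for s
    unfolding B_def sets by (rule finite_borel_partition_saturated[OF Q[of s]]) (simp add: cell)
  have "summable (\<lambda>n. measure \<pi> (B d n))"
    using lim by (rule exponential_decay_summable) simp
  \<comment> \<open>By invariance the preimages may be dropped, which leaves a shifted copy of the
    summable series.\<close>
  then have sum: "summable (\<lambda>s. measure \<pi> ((f ^^ triangle s) -` B d (Suc s)))"
    by (simp add: invariant_measure_funpow_vimage[OF inv B_meas]
        summable_Suc_iff[of "\<lambda>n. measure \<pi> (B d n)"])
  have "AE x in \<pi>. \<forall>\<^sub>F s in sequentially. x \<in> space \<pi> - (f ^^ triangle s) -` B d (Suc s)"
    by (rule borel_cantelli_AE1[OF _ _ sum])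
       (auto simp: invariant_measure_funpow_vimage[OF inv B_meas] less_top[symmetric])
  then have "AE x in \<pi>. limsup (\<lambda>t. ereal (dist ((f ^^ t) x) (estimate f \<delta> \<gamma> x t))) \<le> ereal \<epsilon>"
  proof eventually_elim
    case (elim x)
    have "\<forall>\<^sub>F s in sequentially. \<forall>m\<le>s.
        dist ((f ^^ (triangle s + m)) x) (estimate f \<delta> \<gamma> x (triangle s + m)) \<le> \<epsilon>"
      using elim est
    proof eventually_elim
      case (elim s)
      let ?z = "(f ^^ triangle s) x"
      obtain A where A: "A \<in> Q s" "?z \<in> A"
        using Q[of s] unfolding finite_borel_partition_def partition_on_def by blast
      have "?z \<notin> B d (Suc s)" using elim by simp
      then have "2 powr (- (real (Suc s) * (h + d))) \<le> measure \<pi> A"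
        unfolding B_def mem_Collect_eq cell[OF A]
        by (rule measure_ge_of_information_le) auto
      with A have AG: "A \<in> G s" by (simp add: G_def)
      show ?case
      proof (intro allI impI)
        fix m assume "m \<le> s"
        then obtain y where y: "y \<in> A" "estimate f \<delta> \<gamma> x (triangle s + m) = (f ^^ m) y"
          using elim AG A by blast
        obtain C where C: "C \<in> P" "(f ^^ m) ?z \<in> C" "(f ^^ m) y \<in> C"
          using join_partition_same_cell[of A f P "Suc s" ?z y m] A y \<open>m \<le> s\<close> unfolding Q_def by auto
        \<comment> \<open>Boundedness of the space makes \<open>diameter\<close> a genuine bound on
          distances within a cell.\<close>
        have "dist ((f ^^ m) ?z) ((f ^^ m) y) \<le> diameter C"
          using C bounded_subset[OF assms(1)] by (intro diameter_bounded_bound) auto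
        also have "\<dots> \<le> \<epsilon>" using diam C by (simp add: less_imp_le)
        finally have "dist ((f ^^ m) ?z) (estimate f \<delta> \<gamma> x (triangle s + m)) \<le> \<epsilon>"
          by (simp only: y)
        moreover have "(f ^^ (triangle s + m)) x = (f ^^ m) ?z"
          by (simp add: add.commute[of _ m] funpow_add)
        ultimately show "dist ((f ^^ (triangle s + m)) x) (estimate f \<delta> \<gamma> x (triangle s + m)) \<le> \<epsilon>"
          by simp
      qed
    qed
    then obtain S where S: "\<And>s m. \<lbrakk>S \<le> s; m \<le> s\<rbrakk> \<Longrightarrow>
        dist ((f ^^ (triangle s + m)) x) (estimate f \<delta> \<gamma> x (triangle s + m)) \<le> \<epsilon>"
      unfolding eventually_sequentially by blast
    have "\<forall>\<^sub>F t in sequentially. dist ((f ^^ t) x) (estimate f \<delta> \<gamma> x t) \<le> \<epsilon>"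
      using eventually_ge_at_top[of "triangle S"]
    proof eventually_elim
      case (elim t)
      obtain s m where t: "t = triangle s + m" "m \<le> s" by (rule triangle_decomposition)
      \<comment> \<open>A time in block \<open>s\<close> precedes \<open>triangle (Suc s)\<close>,
        so a time from \<open>triangle S\<close> on lies in block \<open>S\<close> or later.\<close>
      have "S \<le> s"
      proof (rule ccontr)
        assume "\<not> S \<le> s"
        then have "triangle (Suc s) \<le> triangle S" by (intro monoD[OF mono_triangle]) simp
        with elim t show False by simp
      qed
      with S t show ?case by simp
    qed
    then show ?case by (intro Limsup_bounded) (auto elim: eventually_mono)
  qed
  then have "achieves_E2 \<pi> f \<epsilon> \<delta> \<gamma>"
    by (simp add: achieves_E2_iff_AE[OF inv pol])
  with pol k(2) show ?thesis
    unfolding C_eps_def by (intro Inf_lower CollectI exI[of _ "{..<k}"]) auto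
qed

theorem mainTheorem3:
  fixes f :: "'a::metric_space \<Rightarrow> 'a" and \<pi> :: "'a measure"
  assumes "compact (UNIV :: 'a set)"
    and "\<exists>g. homeomorphism UNIV UNIV f g"
    and "ergodic \<pi> f"
    and "\<And>\<eta>::real. \<eta> > 0 \<Longrightarrow>
           \<exists>P. finite_borel_partition P \<and> (\<forall>A\<in>P. diameter A < \<eta>) \<and>
               metric_entropy \<pi> f = ereal (entropy_wrt \<pi> f P) \<and>
               (\<forall>\<^sub>F \<delta> in at_right (0::real).
                  limsup (\<lambda>n. ereal (1 / real n) *
                    elog (measure \<pi>
                      {x. \<bar>- (ereal (1 / real n) * elog (measure \<pi> (partition_cell f P n x)))
                            - ereal (entropy_wrt \<pi> f P)\<bar> > ereal \<delta>})) < 0)"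
  shows "C_zero \<pi> f \<le>
           ereal (log 2 (1 + of_int \<lfloor>2 powr real_of_ereal (metric_entropy \<pi> f)\<rfloor>))"
proof -
  obtain g where "homeomorphism UNIV UNIV f g" using assms(2) by blast
  then have "surj f" by (auto simp: homeomorphism_def)
  have inv: "invariant_prob \<pi> f" using assms(3) by (simp add: ergodic_def)
  define h where "h = real_of_ereal (metric_entropy \<pi> f)"
  \<comment> \<open>The least integer strictly above \<open>2 powr h\<close>. It depends on the
    metric entropy alone, so one alphabet size serves every \<epsilon>.\<close>
  define k where "k = nat (1 + \<lfloor>2 powr h\<rfloor>)"
  have "0 \<le> \<lfloor>2 powr h\<rfloor>" by simp
  then have k0: "0 < k" and k_real: "real k = 1 + of_int \<lfloor>2 powr h\<rfloor>" unfolding k_def by linarith+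
  have "2 powr h < real k" unfolding k_real by linarith
  then have hk: "h < log 2 (real k)" using k0 by (simp add: less_log_iff)
  have "C_eps \<pi> f \<epsilon> \<le> ereal (log 2 (real k))" if pos: "0 < \<epsilon>" for \<epsilon>
  proof -
    obtain P where P: "finite_borel_partition P" "\<And>A. A \<in> P \<Longrightarrow> diameter A < \<epsilon>"
      and h: "metric_entropy \<pi> f = ereal (entropy_wrt \<pi> f P)"
      and dev: "\<forall>\<^sub>F \<delta> in at_right (0::real).
                  limsup (\<lambda>n. ereal (1 / real n) *
                    elog (measure \<pi>
                      {x. \<bar>- (ereal (1 / real n) * elog (measure \<pi> (partition_cell f P n x)))
                            - ereal (entropy_wrt \<pi> f P)\<bar> > ereal \<delta>})) < 0"
      using assms(4)[OF pos] by blast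
    have "entropy_wrt \<pi> f P = h" by (simp add: h_def h)
    with dev show ?thesis
      using C_eps_le_log[OF compact_imp_bounded[OF assms(1)] inv \<open>surj f\<close> P _ hk k0] by simp
  qed
  then have "C_zero \<pi> f \<le> ereal (log 2 (real k))" by (rule C_zero_le[OF inv])
  then show ?thesis by (simp add: k_real h_def)
qed

end
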